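(* Let $n\ge 1$, let $C\subset\mathbb{R}^n$ be a convex body that is centrally symmetric about the origin, and let $M_C=(\mathbb{R}^n,\|\cdot\|_C)$ be the $n$-dimensional normed space with unit ball $C$. Then for every bounded set $S\subset\mathbb{R}^n$ with at least two points (so that $d_C(S)>0$), $$b_C(S)\leq 2^{n}\bigl((n+1)\log (n+1)+(n+1)\log \log (n+1)+5n+5\bigr).$$
   Context: A convex body in $\mathbb{R}^n$ is a compact convex set with nonempty interior. For a convex body $C$ centrally symmetric about the origin, the associated norm is $\|\mathbf{x}\|_C=\min\{r\ge 0:\ \mathbf{x}\in rC\}$, and the distance between $\mathbf{x},\mathbf{y}$ is $\|\mathbf{x}-\mathbf{y}\|_C$. (The phrase "$n$-dimensional metric space" here means $\mathbb{R}^n$ with such a norm.) For a bounded set $S$, its diameter is $d_C(S)=\sup\{\|\mathbf{x}-\mathbf{y}\|_C:\ \mathbf{x},\mathbf{y}\in S\}$, and $b_C(S)$ is the smallest number $m$ such that $S$ can be divided into $m$ subsets (i.e. $S$ is the union of $m$ subsets), each having $d_C$-diameter strictly smaller than $d_C(S)$. Here $\log$ is the natural logarithm. *)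

theory Defs
  imports "HOL-Analysis.Analysis"
begin

definition convex_body :: "(real ^ 'n) set \<Rightarrow> bool" where
  "convex_body C \<longleftrightarrow> compact C \<and> convex C \<and> interior C \<noteq> {}"

definition centrally_symmetric :: "(real ^ 'n) set \<Rightarrow> bool" where
  "centrally_symmetric C \<longleftrightarrow> (\<forall>x\<in>C. - x \<in> C)"

(* The minimum exists whenever C is a centrally symmetric convex body;
   for other C the value is not meaningful. *)
definition norm_of :: "(real ^ 'n) set \<Rightarrow> real ^ 'n \<Rightarrow> real" where
  "norm_of C x = (LEAST r. 0 \<le> r \<and> x \<in> (\<lambda>y. r *\<^sub>R y) ` C)"

(* As for the library's diameter, the empty set gets diameter 0. *)
definition diameter_of :: "(real ^ 'n) set \<Rightarrow> (real ^ 'n) set \<Rightarrow> real" where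
  "diameter_of C S = (if S = {} then 0 else SUP (x, y) \<in> S \<times> S. norm_of C (x - y))"

definition divisible_into :: "(real ^ 'n) set \<Rightarrow> (real ^ 'n) set \<Rightarrow> nat \<Rightarrow> bool" where
  "divisible_into C S m \<longleftrightarrow>
     (\<exists>A :: nat \<Rightarrow> (real ^ 'n) set.
        S = (\<Union>i<m. A i) \<and> (\<forall>i<m. diameter_of C (A i) < diameter_of C S))"

(* The infimum in enat is the least such m, and is infinite if there is none, so
   that a finite upper bound asserts in particular that a division exists. *)
definition borsuk_number :: "(real ^ 'n) set \<Rightarrow> (real ^ 'n) set \<Rightarrow> enat" where
  "borsuk_number C S = (INF m \<in> {m. divisible_into C S m}. enat m)"

end

theory Submission
  imports Defs
begin

text \<open>
  Suppose first that \<open>S\<close> is a convex body \<open>K\<close>. A translate of \<open>- \<lambda> K\<close> with \<open>\<lambda> < 1\<close> has smaller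
  diameter than \<open>K\<close>, so it suffices to cover \<open>K\<close> by few such translates. Using reflected copies of
  \<open>K\<close> instead of balls makes the volume ratio exact without any isoperimetric inequality:
  \<open>K + \<lambda> K = (1 + \<lambda>) K\<close> has at most \<open>(2 / \<lambda>)\<^sup>n\<close> times the volume of \<open>\<lambda> K\<close>. A Rogers-type
  argument then gives the cover: replace \<open>K\<close> by a finite net of about \<open>(4 / \<delta>)\<^sup>n\<close> points, cover the
  net greedily, where each step catches at least a fraction \<open>(\<mu> / 2)\<^sup>n\<close> of the remaining points, and
  cover the last \<open>2\<^sup>n\<close> points one by one. The choice \<open>\<delta> = 1 / (4 (n + 1) ln (n + 1))\<close> gives the
  bound. A general \<open>S\<close> is first enlarged to the convex body \<open>closure (conv S) + \<epsilon> C\<close>, whose diameter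
  exceeds that of \<open>S\<close> by at most \<open>2 \<epsilon>\<close>.
\<close>

section \<open>Averaging and volumes of homothetic copies\<close>

text \<open>If \<open>f < a\<close> held on all of \<open>Q\<close>, the integral over
  \<open>Q\<close> would lie strictly below \<open>a * emeasure M Q\<close>, since \<open>Q\<close>
  is not null and the integrals are finite.\<close>

lemma nn_integral_exists_ge_average:
  fixes f :: "'a \<Rightarrow> ennreal"
  assumes f [measurable]: "f \<in> borel_measurable M" and Q [measurable]: "Q \<in> sets M"
    and Q_pos: "emeasure M Q \<noteq> 0" and Q_fin: "emeasure M Q < \<infinity>" and a: "a < \<infinity>"
    and avg: "a * emeasure M Q \<le> (\<integral>\<^sup>+x. f x * indicator Q x \<partial>M)"
  shows "\<exists>x\<in>Q. a \<le> f x"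
proof (rule ccontr)
  assume "\<not> ?thesis"
  then have less: "f x < a" if "x \<in> Q" for x
    using that by (auto simp: not_le)
  have const: "(\<integral>\<^sup>+x. a * indicator Q x \<partial>M) = a * emeasure M Q"
    by (simp add: nn_integral_cmult_indicator)
  have "(\<integral>\<^sup>+x. f x * indicator Q x \<partial>M) \<le> (\<integral>\<^sup>+x. a * indicator Q x \<partial>M)"
    using less by (intro nn_integral_mono) (auto simp: indicator_def less_imp_le)
  also have "\<dots> < \<infinity>"
    using a Q_fin unfolding const by (simp add: ennreal_mult_less_top)
  finally have fin: "(\<integral>\<^sup>+x. f x * indicator Q x \<partial>M) \<noteq> \<infinity>"
    by simp
  have "\<not> (AE x in M. a * indicator Q x \<le> f x * indicator Q x)"
  proof
    assume "AE x in M. a * indicator Q x \<le> f x * indicator Q x"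
    then have "AE x in M. x \<notin> Q"
      by eventually_elim (use less in \<open>auto simp: indicator_def not_le[symmetric] split: if_splits\<close>)
    then show False
      using Q_pos by (subst (asm) AE_iff_measurable[of Q]) (use sets.sets_into_space[OF Q] in auto)
  qed
  moreover have "AE x in M. f x * indicator Q x \<le> a * indicator Q x"
    using less by (auto simp: indicator_def less_imp_le)
  ultimately have "(\<integral>\<^sup>+x. f x * indicator Q x \<partial>M) < (\<integral>\<^sup>+x. a * indicator Q x \<partial>M)"
    by (intro nn_integral_less fin) auto
  then show False
    using avg const by simp
qed

lemma emeasure_lborel_compact:
  "compact K \<Longrightarrow> emeasure lborel K = ennreal (measure lebesgue K)"
  by (metis emeasure_compact_finite borel_compact emeasure_eq_ennreal_measure infinity_ennreal_def
      less_irrefl measure_completion sets_lborel)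

lemma measure_lebesgue_translate_scale:
  fixes K :: "'a::euclidean_space set"
  shows "measure lebesgue ((\<lambda>x. a + c *\<^sub>R x) ` K) = \<bar>c\<bar> ^ DIM('a) * measure lebesgue K"
  using measure_lebesgue_affine[of c a K] by (simp add: add.commute)

lemma compact_translate_scale:
  fixes K :: "'a::real_normed_vector set"
  shows "compact K \<Longrightarrow> compact ((\<lambda>x. a + c *\<^sub>R x) ` K)"
  by (intro compact_continuous_image continuous_intros)

text \<open>Minkowski arithmetic in elementwise form: convexity enters the packing and covering
  arguments through \<open>a K + b K \<subseteq> (a + b) K\<close>.\<close>

lemma convex_scaleR_add_scaleR:
  assumes "convex K" "x \<in> K" "y \<in> K" "0 \<le> a" "0 \<le> b" "0 < a + b"
  obtains z where "z \<in> K" "a *\<^sub>R x + b *\<^sub>R y = (a + b) *\<^sub>R z"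
proof
  show "(a / (a + b)) *\<^sub>R x + (b / (a + b)) *\<^sub>R y \<in> K"
    using assms by (intro convexD) (auto simp: add_divide_distrib[symmetric])
  show "a *\<^sub>R x + b *\<^sub>R y = (a + b) *\<^sub>R ((a / (a + b)) *\<^sub>R x + (b / (a + b)) *\<^sub>R y)"
    using assms by (simp add: scaleR_add_right)
qed

text \<open>The mean of the volume of \<open>K \<inter> (c - K)\<close> over all \<open>c\<close> in \<open>2 K\<close> is \<open>vol K / 2\<^sup>n\<close>, by Tonelli.\<close>

lemma exists_large_symmetric_part:
  fixes K :: "'a::euclidean_space set"
  assumes K: "compact K" "convex K" and pos: "0 < measure lebesgue K"
  shows "\<exists>c. measure lebesgue K \<le> 2 ^ DIM('a) * measure lebesgue (K \<inter> (\<lambda>x. c - x) ` K)"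
proof -
  define Q where "Q = (\<lambda>x. 0 + 2 *\<^sub>R x) ` K"
  define f where "f c = (\<integral>\<^sup>+y. indicator K y * indicator K (c - y) \<partial>lborel)" for c :: 'a
  have K_borel [measurable]: "K \<in> sets borel"
    using K by (simp add: borel_compact)
  have Q_compact: "compact Q"
    unfolding Q_def using K by (intro compact_translate_scale)
  have refl_compact: "compact ((\<lambda>x. c - x) ` K)" for c
    using K by (intro compact_continuous_image continuous_intros)
  have f_eq: "f c = ennreal (measure lebesgue (K \<inter> (\<lambda>x. c - x) ` K))" for c
  proof -
    have "f c = (\<integral>\<^sup>+y. indicator (K \<inter> (\<lambda>x. c - x) ` K) y \<partial>lborel)"
      unfolding f_def by (intro nn_integral_cong) (auto simp: indicator_def image_iff)
    also have "\<dots> = emeasure lborel (K \<inter> (\<lambda>x. c - x) ` K)"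
      using K refl_compact[of c] by (intro nn_integral_indicator) (auto simp: borel_compact)
    finally show ?thesis
      using K refl_compact[of c] by (simp add: emeasure_lborel_compact compact_Int)
  qed
  have f_meas: "f \<in> borel_measurable lborel"
    unfolding f_def by measurable
  \<comment> \<open>Averaging over \<open>Q\<close> loses nothing: if \<open>x\<close> and
    \<open>c - x\<close> both lie in \<open>K\<close>, then \<open>c\<close> lies in
    \<open>K + K = 2 K = Q\<close>.\<close>
  have zero: "f c = 0" if "c \<notin> Q" for c
  proof -
    have "K \<inter> (\<lambda>x. c - x) ` K = {}"
    proof safe
      fix x assume "c - x \<in> K" "x \<in> K"
      then obtain z where "z \<in> K" "1 *\<^sub>R (c - x) + 1 *\<^sub>R x = (1 + 1) *\<^sub>R z"
        by (rule convex_scaleR_add_scaleR[OF K(2), of "c - x" x 1 1]) auto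
      then have "c \<in> Q"
        by (auto simp: Q_def)
      then show "c - x \<in> {}"
        using that by simp
    qed
    then show ?thesis
      by (simp add: f_eq)
  qed
  have inner: "(\<integral>\<^sup>+c. indicator K (c - y) \<partial>lborel) = ennreal (measure lebesgue K)" for y
  proof -
    have "(\<integral>\<^sup>+c. indicator K (c - y) \<partial>lborel) = (\<integral>\<^sup>+c. indicator ((\<lambda>x. y + 1 *\<^sub>R x) ` K) c \<partial>lborel)"
      by (intro nn_integral_cong) (auto simp: indicator_def image_iff algebra_simps)
    also have "\<dots> = emeasure lborel ((\<lambda>x. y + 1 *\<^sub>R x) ` K)"
      using compact_translate_scale[OF K(1), of y 1]
      by (intro nn_integral_indicator) (auto simp: borel_compact)
    finally show ?thesis
      using compact_translate_scale[OF K(1), of y 1] measure_lebesgue_translate_scale[of y 1 K]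
      by (simp add: emeasure_lborel_compact)
  qed
  have "(\<integral>\<^sup>+c. f c * indicator Q c \<partial>lborel) = (\<integral>\<^sup>+c. f c \<partial>lborel)"
    using zero by (intro nn_integral_cong) (auto simp: indicator_def)
  also have "\<dots> = (\<integral>\<^sup>+y. (\<integral>\<^sup>+c. indicator K y * indicator K (c - y) \<partial>lborel) \<partial>lborel)"
    unfolding f_def by (rule lborel_pair.Fubini') measurable
  also have "\<dots> = (\<integral>\<^sup>+y. indicator K y * ennreal (measure lebesgue K) \<partial>lborel)"
    by (simp add: nn_integral_cmult inner)
  also have "\<dots> = ennreal (measure lebesgue K) * ennreal (measure lebesgue K)"
    using K by (simp add: nn_integral_multc emeasure_lborel_compact)
  finally have total: "(\<integral>\<^sup>+c. f c * indicator Q c \<partial>lborel) = ennreal (measure lebesgue K * measure lebesgue K)"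
    by (simp add: ennreal_mult)
  have Q_measure: "emeasure lborel Q = ennreal (2 ^ DIM('a) * measure lebesgue K)"
    using emeasure_lborel_compact[OF Q_compact] measure_lebesgue_translate_scale[of 0 2 K]
    by (simp add: Q_def del: measure_completion)
  have "\<exists>c\<in>Q. ennreal (measure lebesgue K / 2 ^ DIM('a)) \<le> f c"
  proof (rule nn_integral_exists_ge_average[OF f_meas])
    show "Q \<in> sets lborel"
      using Q_compact by (simp add: borel_compact)
    show "ennreal (measure lebesgue K / 2 ^ DIM('a)) * emeasure lborel Q
      \<le> (\<integral>\<^sup>+c. f c * indicator Q c \<partial>lborel)"
      unfolding total Q_measure by (simp add: ennreal_mult[symmetric])
  qed (use pos in \<open>auto simp: Q_measure\<close>)
  then show ?thesis
    by (auto simp: f_eq field_simps)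
qed

section \<open>Reflected nets from volume packings\<close>

text \<open>Every copy \<open>x + \<eta> D\<close> lies in
  \<open>K + \<eta> K = (1 + \<eta>) K\<close>, and the volumes of disjoint copies add up.\<close>

lemma disjoint_homothets_card_le:
  fixes D K :: "'a::euclidean_space set"
  assumes D: "compact D" "D \<subseteq> K" and K: "compact K" "convex K" and "0 < \<eta>"
    and F: "finite F" "F \<subseteq> K" "disjoint_family_on (\<lambda>x. (\<lambda>u. x + \<eta> *\<^sub>R u) ` D) F"
  shows "real (card F) * (\<eta> ^ DIM('a) * measure lebesgue D) \<le> (1 + \<eta>) ^ DIM('a) * measure lebesgue K"
proof -
  let ?A = "\<lambda>x. (\<lambda>u. x + \<eta> *\<^sub>R u) ` D"
  have A: "?A x \<in> lmeasurable" for x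
    using D by (intro lmeasurable_compact compact_translate_scale)
  have "real (card F) * (\<eta> ^ DIM('a) * measure lebesgue D) = (\<Sum>x\<in>F. measure lebesgue (?A x))"
    using \<open>0 < \<eta>\<close> by (simp add: measure_lebesgue_translate_scale)
  also have "\<dots> = measure lebesgue (\<Union>x\<in>F. ?A x)"
    using F fmeasurableD[OF A] fmeasurableD2[OF A] by (intro measure_finite_Union[symmetric]) (auto simp del: emeasure_completion)
  also have "\<dots> \<le> measure lebesgue ((\<lambda>x. 0 + (1 + \<eta>) *\<^sub>R x) ` K)"
  proof (rule measure_mono_fmeasurable)
    show "(\<Union>x\<in>F. ?A x) \<subseteq> (\<lambda>x. 0 + (1 + \<eta>) *\<^sub>R x) ` K"
    proof safe
      fix x u assume "x \<in> F" "u \<in> D"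
      then obtain z where "z \<in> K" "1 *\<^sub>R x + \<eta> *\<^sub>R u = (1 + \<eta>) *\<^sub>R z"
        using convex_scaleR_add_scaleR[OF K(2), of x u 1 \<eta>] F D \<open>0 < \<eta>\<close>
        by (metis add_pos_pos in_mono less_eq_real_def zero_less_one)
      then show "x + \<eta> *\<^sub>R u \<in> (\<lambda>x. 0 + (1 + \<eta>) *\<^sub>R x) ` K"
        by auto
    qed
    show "(\<Union>x\<in>F. ?A x) \<in> sets lebesgue"
      using F A by (intro sets.finite_UN) (auto simp: fmeasurable_def)
    show "(\<lambda>x. 0 + (1 + \<eta>) *\<^sub>R x) ` K \<in> lmeasurable"
      using K by (intro lmeasurable_compact compact_translate_scale)
  qed
  also have "\<dots> = (1 + \<eta>) ^ DIM('a) * measure lebesgue K"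
    using \<open>0 < \<eta>\<close> unfolding measure_lebesgue_translate_scale by simp
  finally show ?thesis .
qed

text \<open>A largest packing by copies of \<open>K\<close> itself would only give differences in
  \<open>\<eta> (K - K)\<close>. Packing with the symmetric part \<open>D\<close> gives one-sided
  differences in \<open>\<delta> K\<close>; the lost volume costs a factor \<open>2^n\<close> in the
  count. Keeping only the points that serve some \<open>y\<close> in \<open>K\<close> puts the net
  inside \<open>K + \<delta> K\<close>.\<close>

lemma exists_reflected_net:
  fixes K :: "'a::euclidean_space set"
  assumes K: "compact K" "convex K" and pos: "0 < measure lebesgue K" and "0 < \<delta>"
  shows "\<exists>Z. finite Z \<and> real (card Z) \<le> (2 + 4 / \<delta>) ^ DIM('a) \<and>
    (\<forall>z\<in>Z. \<exists>y\<in>K. \<exists>k\<in>K. z = y + \<delta> *\<^sub>R k) \<and> (\<forall>y\<in>K. \<exists>z\<in>Z. \<exists>k\<in>K. z = y + \<delta> *\<^sub>R k)"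
proof -
  define \<eta> where "\<eta> = \<delta> / 2"
  obtain c where c: "measure lebesgue K \<le> 2 ^ DIM('a) * measure lebesgue (K \<inter> (\<lambda>x. c - x) ` K)"
    using exists_large_symmetric_part[OF K pos] by blast
  define D where "D = K \<inter> (\<lambda>x. c - x) ` K"
  have \<eta>: "0 < \<eta>" and D_compact: "compact D" and D_sub: "D \<subseteq> K"
    using K \<open>0 < \<delta>\<close> by (auto simp: D_def \<eta>_def intro!: compact_Int compact_continuous_image continuous_intros)
  have D_pos: "0 < measure lebesgue D"
    using c pos unfolding D_def by (metis less_le_trans zero_less_mult_pos zero_less_numeral zero_less_power)
  let ?A = "\<lambda>x. (\<lambda>u. x + \<eta> *\<^sub>R u) ` D"
  define P where "P F \<longleftrightarrow> finite F \<and> F \<subseteq> K \<and> disjoint_family_on ?A F" for F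
  have card_le: "real (card F) \<le> (2 + 4 / \<delta>) ^ DIM('a)" if "P F" for F
  proof -
    have "real (card F) * (\<eta> ^ DIM('a) * measure lebesgue D) \<le> (1 + \<eta>) ^ DIM('a) * measure lebesgue K"
      using that K D_compact D_sub \<eta> unfolding P_def by (intro disjoint_homothets_card_le) auto
    also have "\<dots> \<le> (1 + \<eta>) ^ DIM('a) * (2 ^ DIM('a) * measure lebesgue D)"
      using c \<eta> unfolding D_def by (intro mult_left_mono) auto
    finally have "real (card F) * \<eta> ^ DIM('a) \<le> (1 + \<eta>) ^ DIM('a) * 2 ^ DIM('a)"
      using D_pos by (simp add: mult.assoc[symmetric])
    then have "real (card F) \<le> ((1 + \<eta>) * 2 / \<eta>) ^ DIM('a)"
      using \<eta> by (simp add: power_divide pos_le_divide_eq flip: power_mult_distrib)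
    also have "(1 + \<eta>) * 2 / \<eta> = 2 + 4 / \<delta>"
      using \<open>0 < \<delta>\<close> by (simp add: \<eta>_def field_simps)
    finally show ?thesis .
  qed
  have "P {}"
    by (simp add: P_def disjoint_family_on_def)
  \<comment> \<open>The volume bound caps the size of a packing, so one of greatest cardinality
    exists. Its maximality forces the copy at any point of \<open>K\<close> to meet some copy in the
    packing.\<close>
  moreover have "\<forall>F. P F \<longrightarrow> card F < Suc (nat \<lfloor>(2 + 4 / \<delta>) ^ DIM('a)\<rfloor>)"
    using card_le by (auto simp: less_Suc_eq_le le_nat_floor)
  ultimately obtain F where F: "P F" "\<And>G. P G \<Longrightarrow> card G \<le> card F"
    using ex_has_greatest_nat[of P "{}" card] by blast
  \<comment> \<open>Since \<open>D = c - D\<close>, two overlapping copies \<open>x + \<eta> D\<close> and \<open>y + \<eta> D\<close> give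
    \<open>x + \<eta> c \<in> y + \<eta> (D + D) \<subseteq> y + \<delta> K\<close>; this is where the shift by \<open>\<eta> c\<close> comes from.\<close>
  define Z where "Z = {z \<in> (\<lambda>x. x + \<eta> *\<^sub>R c) ` F. \<exists>y\<in>K. \<exists>k\<in>K. z = y + \<delta> *\<^sub>R k}"
  have finF: "finite F"
    using F by (simp add: P_def)
  have "card Z \<le> card F"
    unfolding Z_def using finF by (intro order_trans[OF card_mono card_image_le]) auto
  moreover have "\<exists>z\<in>Z. \<exists>k\<in>K. z = y + \<delta> *\<^sub>R k" if y: "y \<in> K" for y
  proof -
    have "\<exists>x\<in>F. ?A x \<inter> ?A y \<noteq> {}"
    proof (cases "y \<in> F")
      case True
      have "D \<noteq> {}"
        using D_pos by auto
      then show ?thesis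
        using True by auto
    next
      case False
      show ?thesis
      proof (rule ccontr)
        assume "\<not> ?thesis"
        then have "P (insert y F)"
          using F(1) y False unfolding P_def by (auto simp: disjoint_family_on_insert)
        then show False
          using F(2)[of "insert y F"] finF False by simp
      qed
    qed
    then obtain x u v where x: "x \<in> F" and uv: "u \<in> D" "v \<in> D" "x + \<eta> *\<^sub>R u = y + \<eta> *\<^sub>R v"
      by auto
    obtain w where w: "w \<in> K" "u = c - w"
      using uv(1) by (auto simp: D_def)
    obtain k where k: "k \<in> K" "1 *\<^sub>R v + 1 *\<^sub>R w = (1 + 1) *\<^sub>R k"
      using convex_scaleR_add_scaleR[OF K(2), of v w 1 1] uv(2) w D_sub by auto
    have "x + \<eta> *\<^sub>R c = y + \<eta> *\<^sub>R (1 *\<^sub>R v + 1 *\<^sub>R w)"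
      using uv(3) unfolding w(2) by (simp add: algebra_simps)
    also have "\<dots> = y + \<delta> *\<^sub>R k"
      unfolding k(2) by (simp add: \<eta>_def)
    finally have eq: "x + \<eta> *\<^sub>R c = y + \<delta> *\<^sub>R k" .
    then have "x + \<eta> *\<^sub>R c \<in> Z"
      unfolding Z_def using x y k(1) by blast
    then show ?thesis
      using eq k(1) by blast
  qed
  moreover have "finite Z" "\<forall>z\<in>Z. \<exists>y\<in>K. \<exists>k\<in>K. z = y + \<delta> *\<^sub>R k"
    using finF by (auto simp: Z_def)
  ultimately show ?thesis
    using card_le[OF F(1)] by (intro exI[of _ Z]) auto
qed

section \<open>Greedy covering by reflected copies\<close>

text \<open>Double counting: the copies \<open>z + \<mu> K\<close> all lie in \<open>Q = q K\<close>
  with \<open>q = 1 + \<delta> + \<mu> \<le> 2\<close>, so the number of copies containing a point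
  has mean \<open>(\<mu> / q)^n * card Z\<close> over \<open>Q\<close>.\<close>

lemma exists_popular_point:
  fixes K :: "'a::euclidean_space set"
  assumes K: "compact K" "convex K" and pos: "0 < measure lebesgue K"
    and \<mu>\<delta>: "0 < \<mu>" "0 \<le> \<delta>" "\<mu> + \<delta> \<le> 1"
    and Z: "finite Z" "\<forall>z\<in>Z. \<exists>y\<in>K. \<exists>k\<in>K. z = y + \<delta> *\<^sub>R k"
  shows "\<exists>x. (\<mu> / 2) ^ DIM('a) * real (card Z) \<le> real (card {z\<in>Z. x \<in> (\<lambda>k. z + \<mu> *\<^sub>R k) ` K})"
proof -
  define q where "q = 1 + \<delta> + \<mu>"
  define Q where "Q = (\<lambda>x. 0 + q *\<^sub>R x) ` K"
  let ?A = "\<lambda>z. (\<lambda>k. z + \<mu> *\<^sub>R k) ` K"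
  define f where "f x = (\<Sum>z\<in>Z. indicator (?A z) x :: ennreal)" for x
  have q: "0 < q" "q \<le> 2"
    using \<mu>\<delta> by (auto simp: q_def)
  have A_compact: "compact (?A z)" for z
    using K by (intro compact_translate_scale)
  have Q_compact: "compact Q"
    unfolding Q_def using K by (intro compact_translate_scale)
  have A_sub: "?A z \<subseteq> Q" if z: "z \<in> Z" for z
  proof safe
    fix k assume k: "k \<in> K"
    obtain y l where y: "y \<in> K" "l \<in> K" "z = y + \<delta> *\<^sub>R l"
      using bspec[OF Z(2) z] by metis
    obtain a where a: "a \<in> K" "1 *\<^sub>R y + \<delta> *\<^sub>R l = (1 + \<delta>) *\<^sub>R a"
      using convex_scaleR_add_scaleR[OF K(2) y(1,2), of 1 \<delta>] \<mu>\<delta> by auto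
    obtain b where b: "b \<in> K" "(1 + \<delta>) *\<^sub>R a + \<mu> *\<^sub>R k = (1 + \<delta> + \<mu>) *\<^sub>R b"
      using convex_scaleR_add_scaleR[OF K(2) a(1) k, of "1 + \<delta>" \<mu>] \<mu>\<delta> by auto
    have "z + \<mu> *\<^sub>R k = q *\<^sub>R b"
      using y a b by (simp add: q_def)
    then show "z + \<mu> *\<^sub>R k \<in> Q"
      using b by (auto simp: Q_def)
  qed
  have A_measure: "emeasure lborel (?A z) = ennreal (\<mu> ^ DIM('a) * measure lebesgue K)" for z
    using \<mu>\<delta>(1) by (simp add: emeasure_lborel_compact[OF A_compact] measure_lebesgue_translate_scale)
  have Q_measure: "emeasure lborel Q = ennreal (q ^ DIM('a) * measure lebesgue K)"
    using emeasure_lborel_compact[OF Q_compact] measure_lebesgue_translate_scale[of 0 q K] q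
    by (simp add: Q_def del: measure_completion)
  have A_borel [measurable]: "?A z \<in> sets borel" for z
    using A_compact by (simp add: borel_compact)
  have f_zero: "f x = 0" if "x \<notin> Q" for x
    unfolding f_def
  proof (intro sum.neutral ballI)
    fix z assume "z \<in> Z"
    then have "x \<notin> ?A z"
      using A_sub that by blast
    then show "indicator (?A z) x = (0 :: ennreal)"
      by (rule indicator_simps(2))
  qed
  have f_eq: "f x = ennreal (real (card {z\<in>Z. x \<in> ?A z}))" for x
  proof -
    have "f x = (\<Sum>z\<in>Z. ennreal (if x \<in> ?A z then 1 else 0))"
      unfolding f_def by (intro sum.cong) (auto simp: indicator_def)
    also have "\<dots> = ennreal (\<Sum>z\<in>Z. if x \<in> ?A z then 1 else 0)"
      by (intro sum_ennreal) auto
    also have "(\<Sum>z\<in>Z. if x \<in> ?A z then 1 else 0) = real (card {z\<in>Z. x \<in> ?A z})"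
      using Z(1) by (simp add: sum.inter_filter[symmetric])
    finally show ?thesis .
  qed
  have "(\<integral>\<^sup>+x. f x * indicator Q x \<partial>lborel) = (\<integral>\<^sup>+x. f x \<partial>lborel)"
    using f_zero by (intro nn_integral_cong) (auto simp: indicator_def)
  also have "\<dots> = (\<Sum>z\<in>Z. emeasure lborel (?A z))"
    unfolding f_def by (subst nn_integral_sum) auto
  also have "\<dots> = ennreal (real (card Z) * (\<mu> ^ DIM('a) * measure lebesgue K))"
    using \<mu>\<delta>(1) pos by (simp add: A_measure ennreal_mult ennreal_of_nat_eq_real_of_nat)
  finally have total: "(\<integral>\<^sup>+x. f x * indicator Q x \<partial>lborel)
      = ennreal (real (card Z) * (\<mu> ^ DIM('a) * measure lebesgue K))" .
  have "\<exists>x\<in>Q. ennreal (real (card Z) * (\<mu> / q) ^ DIM('a)) \<le> f x"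
  proof (rule nn_integral_exists_ge_average)
    show "f \<in> borel_measurable lborel"
      unfolding f_def by measurable
    show "Q \<in> sets lborel"
      using Q_compact by (simp add: borel_compact)
    show "ennreal (real (card Z) * (\<mu> / q) ^ DIM('a)) * emeasure lborel Q
        \<le> (\<integral>\<^sup>+x. f x * indicator Q x \<partial>lborel)"
      unfolding total Q_measure using q pos \<mu>\<delta>(1)
      by (simp add: ennreal_mult[symmetric] power_divide)
  qed (use pos q in \<open>auto simp: Q_measure\<close>)
  then obtain x where "real (card Z) * (\<mu> / q) ^ DIM('a) \<le> real (card {z\<in>Z. x \<in> ?A z})"
    by (auto simp: f_eq)
  moreover have "(\<mu> / 2) ^ DIM('a) \<le> (\<mu> / q) ^ DIM('a)"
    using q \<mu>\<delta>(1) by (intro power_mono divide_left_mono) auto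
  then have "(\<mu> / 2) ^ DIM('a) * real (card Z) \<le> real (card Z) * (\<mu> / q) ^ DIM('a)"
    by (simp add: mult.commute mult_left_mono)
  ultimately show ?thesis
    by (meson order_trans)
qed

text \<open>Each round adds a point that is popular among the copies not yet hit, so their number
  shrinks at least by the factor \<open>1 - (\<mu> / 2)^n\<close>.\<close>

lemma greedy_hitting_set:
  fixes K :: "'a::euclidean_space set"
  assumes K: "compact K" "convex K" and pos: "0 < measure lebesgue K"
    and \<mu>\<delta>: "0 < \<mu>" "0 \<le> \<delta>" "\<mu> + \<delta> \<le> 1"
    and Z: "finite Z" "\<forall>z\<in>Z. \<exists>y\<in>K. \<exists>k\<in>K. z = y + \<delta> *\<^sub>R k"
  shows "\<exists>X. finite X \<and> card X \<le> m \<and>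
    real (card {z\<in>Z. X \<inter> (\<lambda>k. z + \<mu> *\<^sub>R k) ` K = {}}) \<le> (1 - (\<mu> / 2) ^ DIM('a)) ^ m * real (card Z)"
proof (induction m)
  case 0
  show ?case
    by (intro exI[of _ "{}"]) auto
next
  case (Suc m)
  let ?A = "\<lambda>z. (\<lambda>k. z + \<mu> *\<^sub>R k) ` K"
  define p where "p = (\<mu> / 2) ^ DIM('a)"
  have p: "p \<le> 1"
    unfolding p_def using \<mu>\<delta> by (intro power_le_one) auto
  obtain X where X: "finite X" "card X \<le> m"
    "real (card {z\<in>Z. X \<inter> ?A z = {}}) \<le> (1 - p) ^ m * real (card Z)"
    using Suc unfolding p_def by blast
  define R where "R = {z\<in>Z. X \<inter> ?A z = {}}"
  obtain x where x: "p * real (card R) \<le> real (card {z\<in>R. x \<in> ?A z})"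
    using exists_popular_point[OF K pos \<mu>\<delta>, of R] Z unfolding p_def R_def by auto
  have "{z\<in>Z. insert x X \<inter> ?A z = {}} = R - {z\<in>R. x \<in> ?A z}"
    unfolding R_def by auto
  moreover have "finite R"
    using Z by (simp add: R_def)
  then have "card (R - {z\<in>R. x \<in> ?A z}) = card R - card {z\<in>R. x \<in> ?A z}" "card {z\<in>R. x \<in> ?A z} \<le> card R"
    by (auto intro: card_Diff_subset card_mono)
  ultimately have "real (card {z\<in>Z. insert x X \<inter> ?A z = {}}) = real (card R) - real (card {z\<in>R. x \<in> ?A z})"
    by (simp add: of_nat_diff)
  also have "\<dots> \<le> (1 - p) * real (card R)"
    using x by (simp add: algebra_simps)
  also have "\<dots> \<le> (1 - p) * ((1 - p) ^ m * real (card Z))"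
    using X(3) p unfolding R_def by (intro mult_left_mono) auto
  finally have "real (card {z\<in>Z. insert x X \<inter> ?A z = {}}) \<le> (1 - p) ^ Suc m * real (card Z)"
    by (simp add: mult.assoc)
  then show ?case
    using X(1,2) unfolding p_def by (intro exI[of _ "insert x X"]) (auto simp: card_insert_if)
qed

text \<open>If \<open>z - y\<close> lies in \<open>\<delta> K\<close> and \<open>x\<close> hits
  \<open>z + \<mu> K\<close>, then \<open>x - y\<close> lies in \<open>(\<mu> + \<delta>) K\<close>,
  so \<open>y\<close> lies in the reflected copy at \<open>x\<close>. A set hitting all copies at
  the net points therefore consists of the centres of a cover.\<close>

lemma reflected_cover:
  fixes K :: "'a::euclidean_space set"
  assumes K: "compact K" "convex K" and pos: "0 < measure lebesgue K"
    and \<mu>\<delta>: "0 < \<mu>" "0 < \<delta>" "\<mu> + \<delta> \<le> 1"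
  shows "\<exists>X. finite X \<and> K \<subseteq> (\<Union>x\<in>X. (\<lambda>k. x - (\<mu> + \<delta>) *\<^sub>R k) ` K) \<and>
    real (card X) \<le> (2 / \<mu>) ^ DIM('a) * (DIM('a) * ln (1 + 2 / \<delta>)) + 1 + 2 ^ DIM('a)"
proof -
  let ?A = "\<lambda>z. (\<lambda>k. z + \<mu> *\<^sub>R k) ` K"
  define p where "p = (\<mu> / 2) ^ DIM('a)"
  have p: "0 < p" "p \<le> 1"
    unfolding p_def using \<mu>\<delta> by (auto intro: power_le_one)
  \<comment> \<open>Chosen so that \<open>exp (- t)\<close> reduces the size bound of the net to
    \<open>2^n\<close>, because \<open>(2 + 4 / \<delta>)^n = 2^n * exp t\<close>.\<close>
  define t where "t = DIM('a) * ln (1 + 2 / \<delta>)"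
  have exp_t: "exp t = (1 + 2 / \<delta>) ^ DIM('a)"
    using \<mu>\<delta> unfolding t_def by (simp add: exp_of_nat_mult add_pos_pos)
  have t: "0 \<le> t"
    using \<mu>\<delta> by (simp add: t_def)
  \<comment> \<open>This many rounds give \<open>(1 - p)^m \<le> exp (- t)\<close>; rounding up
    accounts for the summand 1 in the bound.\<close>
  define m where "m = nat \<lceil>t / p\<rceil>"
  have m: "t / p \<le> real m" "real m \<le> t / p + 1"
    using t p by (auto simp: m_def real_nat_ceiling_ge of_nat_ceiling)
  obtain Z where Z: "finite Z" "real (card Z) \<le> (2 + 4 / \<delta>) ^ DIM('a)"
    "\<forall>z\<in>Z. \<exists>y\<in>K. \<exists>k\<in>K. z = y + \<delta> *\<^sub>R k" "\<forall>y\<in>K. \<exists>z\<in>Z. \<exists>k\<in>K. z = y + \<delta> *\<^sub>R k"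
    using exists_reflected_net[OF K pos \<mu>\<delta>(2)] by blast
  obtain X where X: "finite X" "card X \<le> m"
    "real (card {z\<in>Z. X \<inter> ?A z = {}}) \<le> (1 - p) ^ m * real (card Z)"
    using greedy_hitting_set[OF K pos \<mu>\<delta>(1) _ \<mu>\<delta>(3) Z(1,3), of m] \<mu>\<delta>(2) unfolding p_def by auto
  define R where "R = {z\<in>Z. X \<inter> ?A z = {}}"
  have "(1 - p) ^ m \<le> exp (- p) ^ m"
    using p exp_ge_add_one_self[of "- p"] by (intro power_mono) auto
  also have "\<dots> = exp (- (p * m))"
    by (simp add: exp_of_nat_mult[symmetric] mult.commute)
  also have "\<dots> \<le> exp (- t)"
    using m(1) p by (simp add: field_simps)
  finally have decay: "(1 - p) ^ m \<le> exp (- t)" .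
  have "real (card R) \<le> (1 - p) ^ m * real (card Z)"
    using X(3) by (simp add: R_def)
  also have "\<dots> \<le> exp (- t) * (2 + 4 / \<delta>) ^ DIM('a)"
    using decay Z(2) by (intro mult_mono) auto
  also have "2 + 4 / \<delta> = 2 * (1 + 2 / \<delta>)"
    by simp
  also have "exp (- t) * (2 * (1 + 2 / \<delta>)) ^ DIM('a) = 2 ^ DIM('a)"
    unfolding power_mult_distrib exp_t[symmetric] by (simp add: exp_minus)
  finally have card_R: "real (card R) \<le> 2 ^ DIM('a)" .
  \<comment> \<open>Any point of \<open>K\<close> serves: each copy still unhit receives a point of
    its own, \<open>z + \<mu> *\<^sub>R k0\<close>.\<close>
  obtain k0 where k0: "k0 \<in> K"
    using pos by fastforce
  define Y where "Y = X \<union> (\<lambda>z. z + \<mu> *\<^sub>R k0) ` R"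
  have "finite R"
    using Z by (simp add: R_def)
  then have finY: "finite Y"
    using X by (simp add: Y_def)
  have "card Y \<le> card X + card R"
    unfolding Y_def using card_Un_le card_image_le[OF \<open>finite R\<close>] by (meson add_left_mono order_trans)
  then have "real (card Y) \<le> (t / p + 1) + 2 ^ DIM('a)"
    using X(2) m(2) card_R by linarith
  also have "t / p = (2 / \<mu>) ^ DIM('a) * t"
    by (simp add: p_def power_divide)
  finally have card_Y: "real (card Y) \<le> (2 / \<mu>) ^ DIM('a) * t + 1 + 2 ^ DIM('a)" .
  have "K \<subseteq> (\<Union>x\<in>Y. (\<lambda>k. x - (\<mu> + \<delta>) *\<^sub>R k) ` K)"
  proof
    fix y assume "y \<in> K"
    then obtain z k where z: "z \<in> Z" "k \<in> K" "z = y + \<delta> *\<^sub>R k"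
      using Z(4) by blast
    have "\<exists>x\<in>Y. x \<in> ?A z"
      using z(1) k0 by (cases "z \<in> R") (auto simp: Y_def R_def)
    then obtain l where l: "l \<in> K" "z + \<mu> *\<^sub>R l \<in> Y"
      by auto
    obtain w where w: "w \<in> K" "\<mu> *\<^sub>R l + \<delta> *\<^sub>R k = (\<mu> + \<delta>) *\<^sub>R w"
      using convex_scaleR_add_scaleR[OF K(2) l(1) z(2), of \<mu> \<delta>] \<mu>\<delta> by auto
    have "y = (z + \<mu> *\<^sub>R l) - (\<mu> + \<delta>) *\<^sub>R w"
      unfolding w(2)[symmetric] using z(3) by simp
    then show "y \<in> (\<Union>x\<in>Y. (\<lambda>k. x - (\<mu> + \<delta>) *\<^sub>R k) ` K)"
      using l(2) w(1) by blast
  qed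
  then show ?thesis
    using finY card_Y unfolding t_def by blast
qed

section \<open>Choice of the parameters\<close>

text \<open>The cover will be applied to a body slightly larger than \<open>S\<close>; the condition
  \<open>\<mu> + \<delta> = 1 - \<delta>\<close> reserves a slack of \<open>\<delta>\<close> for
  this enlargement.\<close>

lemma rogers_parameter_bound:
  fixes n :: nat
  defines "N \<equiv> real n + 1"
  assumes n: "1 \<le> n"
  obtains \<delta> \<mu> where "0 < \<delta>" "0 < \<mu>" "\<mu> + \<delta> = 1 - \<delta>"
    "(2 / \<mu>) ^ n * (n * ln (1 + 2 / \<delta>)) + 1 + 2 ^ n \<le> 2 ^ n * (N * ln N + N * ln (ln N) + 5 * real n + 5)"
proof -
  define L where "L = ln N"
  \<comment> \<open>With this choice \<open>ln (1 + 2 / \<delta>)\<close> is about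
    \<open>ln 8 + ln N + ln (ln N)\<close>, while \<open>(1 / \<mu>)^n\<close> exceeds 1 only by the
    order of \<open>1 / L\<close>, which adds a bounded amount to the logarithm.\<close>
  define \<delta> where "\<delta> = 1 / (4 * N * L)"
  define \<mu> where "\<mu> = 1 - 2 * \<delta>"
  have N: "2 \<le> N"
    using n by (simp add: N_def)
  have L: "2 / 3 \<le> L"
    using N ln_mono[of 2 N] ln2_ge_two_thirds unfolding L_def by linarith
  have NL: "4 / 3 \<le> N * L"
    using mult_mono[OF N L] N by simp
  have \<delta>: "0 < \<delta>" and \<mu>: "0 < \<mu>" "\<mu> + \<delta> = 1 - \<delta>"
    using NL by (auto simp: \<delta>_def \<mu>_def field_simps)
  have arg: "1 + 2 / \<delta> = 1 + 8 * (N * L)"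
    by (simp add: \<delta>_def)
  \<comment> \<open>For \<open>n = 1\<close> the value \<open>ln L = ln (ln 2)\<close> is negative
    and must be bounded from below.\<close>
  have ln_lower: "1 - 1 / L \<le> ln L"
    using ln_le_minus_one[of "1 / L"] L by (simp add: ln_div)
  \<comment> \<open>The claim divided by \<open>2^n\<close>: since \<open>1 \<le> n\<close>, the
    summands \<open>1 + 2^n\<close> are at most \<open>2^n * (3 / 2)\<close>.\<close>
  have key: "(1 / \<mu>) ^ n * (n * ln (1 + 2 / \<delta>)) + 3 / 2 \<le> N * L + N * ln L + 5 * N"
  proof (cases "n = 1")
    \<comment> \<open>The general estimate rests on \<open>1 \<le> L\<close>, which fails for
      \<open>N = 2\<close>; here numerical bounds on \<open>ln 2\<close> suffice.\<close>
    case True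
    then have N2: "N = 2"
      by (simp add: N_def)
    have L_up: "L \<le> 25 / 36"
      using ln2_le_25_over_36 by (simp add: L_def N2)
    have "ln (1 + 2 / \<delta>) \<le> ln (2 ^ 4)"
      unfolding arg using L_up L by (intro ln_mono) (auto simp: N2)
    also have "\<dots> = 4 * ln 2"
      by (subst ln_realpow) auto
    also have "\<dots> \<le> 25 / 9"
      using ln2_le_25_over_36 by simp
    finally have W: "ln (1 + 2 / \<delta>) \<le> 25 / 9" .
    have "1 / \<mu> \<le> 8 / 5"
      using L by (simp add: \<mu>_def \<delta>_def N2 field_simps)
    then have "1 / \<mu> * ln (1 + 2 / \<delta>) \<le> 8 / 5 * (25 / 9)"
      using W \<delta> \<mu> by (intro mult_mono) auto
    moreover have "1 / L \<le> 3 / 2"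
      using L by (simp add: field_simps)
    ultimately show ?thesis
      using L ln_lower unfolding N2 by (simp add: True)
  next
    case False
    then have N3: "3 \<le> N"
      using n by (simp add: N_def)
    have L1: "1 \<le> L"
      using ln_mono[of 3 N] ln3_gt_1 N3 unfolding L_def by linarith
    have lnL: "0 \<le> ln L" "ln L \<le> L - 1"
      using L1 ln_le_minus_one[of L] by auto
    have NL3: "3 \<le> N * L"
      using mult_mono[OF N3 L1] N3 by simp
    define W where "W = ln (1 + 2 / \<delta>)"
    have "W = ln (8 * (N * L) * (1 + 1 / (8 * (N * L))))"
      unfolding W_def arg using NL3 N3 L1 by (simp add: distrib_left add.commute)
    also have "\<dots> = 3 * ln 2 + L + ln L + ln (1 + 1 / (8 * (N * L)))"
    proof -
      have "0 < 1 + 1 / (8 * (N * L))"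
        using NL3 by (intro add_pos_pos) auto
      then have "ln (8 * (N * L) * (1 + 1 / (8 * (N * L)))) = ln 8 + (ln N + ln L) + ln (1 + 1 / (8 * (N * L)))"
        using N3 L1 by (subst ln_mult_pos | simp)+
      then show ?thesis
        using ln_realpow[of 2 3] by (simp add: L_def)
    qed
    \<comment> \<open>\<open>25 / 12\<close> is three times the bound \<open>25 / 36\<close> on
      \<open>ln 2\<close>, and \<open>1 / 24\<close> comes from
      \<open>3 \<le> N * L\<close>.\<close>
    also have "\<dots> \<le> 25 / 12 + L + ln L + 1 / 24"
    proof -
      have "ln (1 + 1 / (8 * (N * L))) \<le> 1 / (8 * (N * L))"
        using NL3 by (intro ln_add_one_self_le_self) auto
      also have "\<dots> \<le> 1 / 24"
        using NL3 by (simp add: field_simps)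
      finally show ?thesis
        using ln2_le_25_over_36 by simp
    qed
    finally have W: "W \<le> L + ln L + 17 / 8"
      by simp
    have W0: "0 \<le> W"
      unfolding W_def using \<delta> by simp
    have inv: "1 / \<mu> = 1 + 1 / (2 * (N * L) - 1)"
      using NL3 N3 L1 by (simp add: \<mu>_def \<delta>_def field_simps)
    have "(1 / \<mu>) ^ n \<le> exp (1 / (2 * (N * L) - 1)) ^ n"
      unfolding inv using NL3 by (intro power_mono exp_ge_add_one_self) auto
    also have "\<dots> = exp (n / (2 * (N * L) - 1))"
      by (simp add: exp_of_nat_mult[symmetric])
    \<comment> \<open>Uses \<open>n = N - 1\<close>:
      \<open>n * (2 * L) = 2 * N * L - 2 * L \<le> 2 * N * L - 1\<close>.\<close>
    also have "\<dots> \<le> exp (1 / (2 * L))"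
      using NL3 L1 by (simp add: N_def field_simps)
    also have "\<dots> \<le> 1 + 1 / (2 * L) + (1 / (2 * L))\<^sup>2"
      using L1 by (intro exp_bound) (auto simp: field_simps)
    also have "\<dots> \<le> 1 + 3 / (4 * L)"
      using L1 by (simp add: field_simps power2_eq_square)
    finally have "(1 / \<mu>) ^ n * W \<le> (1 + 3 / (4 * L)) * W"
      using W0 by (rule mult_right_mono)
    also have "\<dots> = W + 3 / 4 * (W / L)"
      by (simp add: algebra_simps)
    \<comment> \<open>\<open>ln L \<le> L - 1\<close> gives \<open>W \<le> 2 * L + 9 / 8\<close>,
      and \<open>1 \<le> L\<close>. The constants then fit, as
      \<open>17 / 8 + 3 / 4 * (25 / 8) < 9 / 2\<close>.\<close>
    also have "W / L \<le> 25 / 8"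
      using W lnL L1 by (simp add: field_simps)
    finally have bound: "(1 / \<mu>) ^ n * W \<le> L + ln L + 9 / 2"
      using W by simp
    have "n * ((1 / \<mu>) ^ n * W) + 3 / 2 \<le> n * (L + ln L + 9 / 2) + 3 / 2"
      using bound by (intro add_right_mono mult_left_mono) auto
    also have "\<dots> \<le> n * (L + ln L + 5) + (L + ln L + 5)"
      using L1 lnL by (simp add: algebra_simps)
    finally show ?thesis
      by (simp add: W_def N_def algebra_simps)
  qed
  have "1 \<le> (2::real) ^ n * (1 / 2)"
    using power_increasing[of 1 n "2::real"] n by simp
  then have "(2 / \<mu>) ^ n * (n * ln (1 + 2 / \<delta>)) + 1 + 2 ^ n
      \<le> 2 ^ n * ((1 / \<mu>) ^ n * (n * ln (1 + 2 / \<delta>)) + 3 / 2)"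
    by (simp add: power_divide algebra_simps)
  also have "\<dots> \<le> 2 ^ n * (N * L + N * ln L + 5 * N)"
    using key by (rule mult_left_mono) simp
  also have "\<dots> = 2 ^ n * (N * ln N + N * ln (ln N) + 5 * real n + 5)"
    by (simp add: L_def N_def algebra_simps)
  finally show ?thesis
    by (rule that[OF \<delta> \<mu>])
qed

section \<open>The norm of a symmetric convex body and diameters\<close>

text \<open>A small \<open>y\<close> is the midpoint of \<open>x + y\<close> and
  \<open>y - x\<close>, and the latter is the reflection of \<open>x - y\<close>, a point of the
  same ball around \<open>x\<close>.\<close>

lemma zero_in_interior_symmetric:
  assumes "convex_body C" "centrally_symmetric C"
  obtains e where "0 < e" "ball 0 e \<subseteq> C"
proof -
  obtain x e where e: "0 < e" "ball x e \<subseteq> C"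
    using assms(1) by (auto simp: convex_body_def mem_interior ex_in_conv[symmetric])
  have "y \<in> C" if y: "y \<in> ball 0 e" for y
  proof -
    have "x + y \<in> C" "x - y \<in> C"
      using e y by (auto simp: subset_iff dist_norm)
    then have "x + y \<in> C" "y - x \<in> C"
      using assms(2) by (force simp: centrally_symmetric_def)+
    then have "(1 / 2) *\<^sub>R (x + y) + (1 / 2) *\<^sub>R (y - x) \<in> C"
      using assms(1) by (intro convexD) (auto simp: convex_body_def)
    also have "(1 / 2) *\<^sub>R (x + y) + (1 / 2) *\<^sub>R (y - x) = y"
      by (simp add: scaleR_add_right[symmetric] scaleR_2[symmetric])
    finally show ?thesis .
  qed
  then show ?thesis
    using e that by blast
qed

lemma mem_scaled_ball:
  assumes "ball 0 e \<subseteq> C" "0 < e" "norm x < e * r" "0 < r"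
  shows "x \<in> (\<lambda>y. r *\<^sub>R y) ` C"
proof
  show "x = r *\<^sub>R (x /\<^sub>R r)"
    using assms by simp
  show "x /\<^sub>R r \<in> C"
    using assms by (intro subsetD[OF assms(1)]) (simp add: field_simps)
qed

text \<open>\<open>LEAST\<close> on the reals is informative only if the minimum is attained. Pairs
  of a bounded radius \<open>r\<close> and a point \<open>y\<close> of \<open>C\<close> with
  \<open>r *\<^sub>R y = x\<close> form a compact set, so its projection to the radii has a least
  element.\<close>

lemma norm_of_attained:
  assumes "convex_body C" "centrally_symmetric C"
  shows "0 \<le> norm_of C x \<and> x \<in> (\<lambda>y. norm_of C x *\<^sub>R y) ` C"
    and "0 \<le> r \<Longrightarrow> x \<in> (\<lambda>y. r *\<^sub>R y) ` C \<Longrightarrow> norm_of C x \<le> r"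
proof -
  define P where "P r \<longleftrightarrow> 0 \<le> r \<and> x \<in> (\<lambda>y. r *\<^sub>R y) ` C" for r
  obtain e where e: "0 < e" "ball 0 e \<subseteq> C"
    using zero_in_interior_symmetric[OF assms] .
  \<comment> \<open>A radius already admissible for \<open>x\<close>, so that only radii in the
    compact interval \<open>{0..R}\<close> compete for the minimum.\<close>
  define R where "R = (norm x + 1) / e"
  have R: "0 < R" "norm x < e * R"
    using e by (auto simp: R_def add_nonneg_pos)
  have "P R"
    unfolding P_def using mem_scaled_ball[OF e(2,1) R(2,1)] R by simp
  define T where "T = ({0..R} \<times> C) \<inter> {q. fst q *\<^sub>R snd q = x}"
  have "compact ({0..R} \<times> C)"
    using assms(1) by (intro compact_Times) (auto simp: convex_body_def)
  moreover have "closed {q :: real \<times> (real ^ 'a). fst q *\<^sub>R snd q = x}"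
    by (intro closed_Collect_eq continuous_intros)
  ultimately have "compact (fst ` T)"
    unfolding T_def by (intro compact_continuous_image compact_Int_closed continuous_intros)
  moreover have T_iff: "r \<in> fst ` T \<longleftrightarrow> P r \<and> r \<le> R" for r
    by (force simp: T_def P_def image_iff)
  then have "fst ` T \<noteq> {}"
    using \<open>P R\<close> by blast
  ultimately obtain r0 where r0: "r0 \<in> fst ` T" "\<And>r. r \<in> fst ` T \<Longrightarrow> r0 \<le> r"
    by (meson compact_attains_inf)
  have min: "r0 \<le> r" if "P r" for r
    using r0 that unfolding T_iff by (cases "r \<le> R") auto
  have "norm_of C x = r0"
    unfolding norm_of_def using r0(1) min unfolding T_iff P_def by (intro Least_equality) auto
  then show "0 \<le> norm_of C x \<and> x \<in> (\<lambda>y. norm_of C x *\<^sub>R y) ` C"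
    "0 \<le> r \<Longrightarrow> x \<in> (\<lambda>y. r *\<^sub>R y) ` C \<Longrightarrow> norm_of C x \<le> r"
    using r0(1) min unfolding T_iff P_def by auto
qed

text \<open>A real supremum dominates its members only if they are bounded above; a Euclidean ball
  inside \<open>C\<close> provides the bound.\<close>

lemma norm_of_le_diameter_of:
  assumes C: "convex_body C" "centrally_symmetric C" and "bounded S" "x \<in> S" "y \<in> S"
  shows "norm_of C (x - y) \<le> diameter_of C S"
proof -
  obtain e where e: "0 < e" "ball 0 e \<subseteq> C"
    using zero_in_interior_symmetric[OF C] .
  obtain B where B: "\<And>x. x \<in> S \<Longrightarrow> norm x \<le> B" "0 < B"
    using \<open>bounded S\<close> by (auto simp: bounded_pos)
  \<comment> \<open>Differences have Euclidean norm at most \<open>2 * B\<close>;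
    \<open>3 * B\<close> yields the strict inequality that the open ball demands.\<close>
  have "norm_of C (u - v) \<le> 3 * B / e" if "u \<in> S" "v \<in> S" for u v
  proof (rule norm_of_attained(2)[OF C])
    have "norm (u - v) \<le> B + B"
      using B(1)[OF that(1)] B(1)[OF that(2)] norm_triangle_ineq4[of u v] by linarith
    then have "norm (u - v) < e * (3 * B / e)"
      using B(2) e by simp
    then show "u - v \<in> (\<lambda>y. (3 * B / e) *\<^sub>R y) ` C"
      using e B(2) by (intro mem_scaled_ball[of e]) auto
  qed (use e B in auto)
  then have "bdd_above ((\<lambda>(x, y). norm_of C (x - y)) ` (S \<times> S))"
    by (intro bdd_aboveI[of _ "3 * B / e"]) auto
  then have "(case (x, y) of (x, y) \<Rightarrow> norm_of C (x - y)) \<le> (SUP (x, y) \<in> S \<times> S. norm_of C (x - y))"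
    using assms by (intro cSUP_upper) auto
  then show ?thesis
    using assms by (auto simp: diameter_of_def)
qed

lemma diameter_of_le:
  assumes "\<And>x y. x \<in> S \<Longrightarrow> y \<in> S \<Longrightarrow> norm_of C (x - y) \<le> r" "0 \<le> r"
  shows "diameter_of C S \<le> r"
  using assms by (auto simp: diameter_of_def intro!: cSUP_least)

text \<open>One variable at a time: for \<open>s\<close> in \<open>S\<close> the closed convex set
  \<open>s + D\<close> contains \<open>S\<close>, hence the closed hull; then the same argument
  applies to \<open>x - D\<close> for \<open>x\<close> in the closed hull.\<close>

lemma closure_convex_hull_diff_subset:
  fixes S D :: "'a::euclidean_space set"
  assumes D: "closed D" "convex D" and S: "\<And>x y. x \<in> S \<Longrightarrow> y \<in> S \<Longrightarrow> x - y \<in> D"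
    and xy: "x \<in> closure (convex hull S)" "y \<in> closure (convex hull S)"
  shows "x - y \<in> D"
proof -
  have hull: "closure (convex hull S) \<subseteq> T" if "closed T" "convex T" "S \<subseteq> T" for T
    using that by (intro closure_minimal hull_minimal)
  have 1: "x - s \<in> D" if "s \<in> S" for s
  proof -
    have "closure (convex hull S) \<subseteq> (+) s ` D"
      using D S[OF _ that] by (intro hull closed_translation convex_translation) (force simp: image_iff algebra_simps)+
    then show ?thesis
      using xy by (auto simp: image_iff)
  qed
  have "closure (convex hull S) \<subseteq> (-) x ` D"
  proof (intro hull)
    have eq: "(-) x ` D = (+) x ` (uminus ` D)"
      by (auto simp: image_iff)
    show "closed ((-) x ` D)" "convex ((-) x ` D)"
      unfolding eq using D
      by (auto intro!: closed_translation convex_translation closed_negations convex_negations)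
    show "S \<subseteq> (-) x ` D"
      using 1 by (force simp: image_iff algebra_simps)
  qed
  then show ?thesis
    using xy by (auto simp: image_iff)
qed

section \<open>From covers to the Borsuk number\<close>

lemma borsuk_number_le:
  assumes "divisible_into C S m" "real m \<le> r"
  shows "ereal_of_enat (borsuk_number C S) \<le> ereal r"
proof -
  have "borsuk_number C S \<le> enat m"
    unfolding borsuk_number_def using assms(1) by (intro INF_lower) auto
  then have "ereal_of_enat (borsuk_number C S) \<le> ereal_of_enat (enat m)"
    by (simp only: ereal_of_enat_le_iff)
  also have "\<dots> \<le> ereal r"
    using assms(2) by simp
  finally show ?thesis .
qed

lemma measure_convex_body_pos:
  assumes "convex_body C"
  shows "0 < measure lebesgue C"
proof -
  have "\<not> negligible C"
    using assms by (simp add: convex_body_def negligible_convex_interior)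
  then have "measure lebesgue C \<noteq> 0"
    using assms by (simp add: convex_body_def negligible_iff_measure lmeasurable_compact del: measure_completion)
  then show ?thesis
    by (simp add: less_le del: measure_completion)
qed

theorem theorem1p1:
  fixes C S :: "(real ^ 'n) set" and n :: nat
  assumes "n = CARD('n)"
    and "convex_body C" and "centrally_symmetric C"
    and "bounded S" and "\<exists>x\<in>S. \<exists>y\<in>S. x \<noteq> y"
  shows "ereal_of_enat (borsuk_number C S) \<le>
    ereal (2 ^ n * ((real n + 1) * ln (real n + 1)
                    + (real n + 1) * ln (ln (real n + 1)) + 5 * real n + 5))"
proof -
  note C = assms(2,3)
  have C': "compact C" "convex C"
    using C by (auto simp: convex_body_def)
  have DIM: "DIM(real ^ 'n) = n" and n: "1 \<le> n"
    using assms(1) by auto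
  obtain \<delta> \<mu> where \<delta>\<mu>: "0 < \<delta>" "0 < \<mu>" "\<mu> + \<delta> = 1 - \<delta>"
    and bound: "(2 / \<mu>) ^ n * (n * ln (1 + 2 / \<delta>)) + 1 + 2 ^ n
      \<le> 2 ^ n * ((real n + 1) * ln (real n + 1) + (real n + 1) * ln (ln (real n + 1)) + 5 * real n + 5)"
    using rogers_parameter_bound[OF n] .
  define d where "d = diameter_of C S"
  obtain s s' where s: "s \<in> S" "s' \<in> S" "s \<noteq> s'"
    using assms(5) by blast
  \<comment> \<open>Norm 0 would place \<open>s - s'\<close> in \<open>0 C\<close> and so make it
    zero.\<close>
  have "norm_of C (s - s') \<noteq> 0"
    using norm_of_attained(1)[OF C, of "s - s'"] s(3) by auto
  then have d: "0 < d"
    using norm_of_attained(1)[OF C, of "s - s'"] norm_of_le_diameter_of[OF C assms(4) s(1,2)]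
    unfolding d_def by linarith
  define T where "T = closure (convex hull S)"
  have T: "compact T" "convex T" "S \<subseteq> T"
    using assms(4) closure_subset[of "convex hull S"] hull_subset[of S convex]
    by (auto simp: T_def bounded_convex_hull convex_closure)
  have S_diff: "x - y \<in> (\<lambda>c. 0 + d *\<^sub>R c) ` C" if "x \<in> S" "y \<in> S" for x y
  proof -
    obtain c where c: "c \<in> C" "x - y = norm_of C (x - y) *\<^sub>R c"
      using norm_of_attained(1)[OF C, of "x - y"] by blast
    have r: "0 \<le> norm_of C (x - y)" "norm_of C (x - y) \<le> d"
      using norm_of_attained(1)[OF C] norm_of_le_diameter_of[OF C assms(4) that] by (auto simp: d_def)
    have "- c \<in> C"
      using C c(1) by (simp add: centrally_symmetric_def)
    \<comment> \<open>Raises the radius to \<open>d\<close>: splitting the excess evenly between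
      \<open>c\<close> and \<open>- c\<close> keeps the vector and makes the weights sum to
      \<open>d\<close>.\<close>
    then obtain z where z: "z \<in> C" "(norm_of C (x - y) + (d - norm_of C (x - y)) / 2) *\<^sub>R c
        + ((d - norm_of C (x - y)) / 2) *\<^sub>R (- c) = d *\<^sub>R z"
      using convex_scaleR_add_scaleR[OF C'(2) c(1), of "- c" "norm_of C (x - y) + (d - norm_of C (x - y)) / 2"
          "(d - norm_of C (x - y)) / 2"] r d by (auto simp: field_simps)
    have "x - y = d *\<^sub>R z"
      unfolding z(2)[symmetric] using c(2) by (simp add: algebra_simps)
    then show ?thesis
      using z(1) by auto
  qed
  have T_diff: "\<exists>c\<in>C. x - y = d *\<^sub>R c" if "x \<in> T" "y \<in> T" for x y
  proof -
    have "closed ((\<lambda>c. 0 + d *\<^sub>R c) ` C)"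
      using C' by (intro compact_imp_closed compact_translate_scale)
    moreover have "convex ((\<lambda>c. 0 + d *\<^sub>R c) ` C)"
      using convex_scaling[OF C'(2), of d] by simp
    ultimately have "x - y \<in> (\<lambda>c. 0 + d *\<^sub>R c) ` C"
      using S_diff that unfolding T_def by (rule closure_convex_hull_diff_subset)
    then show ?thesis
      by auto
  qed
  \<comment> \<open>Chosen so that
    \<open>(1 - \<delta>) * (d + 2 * \<epsilon>) = d * (1 - \<delta>^2)\<close>, which is below
    \<open>d\<close>.\<close>
  define \<epsilon> where "\<epsilon> = d * \<delta> / 2"
  have \<epsilon>: "0 < \<epsilon>"
    using d \<delta>\<mu> by (simp add: \<epsilon>_def)
  define E where "E = (\<lambda>c. 0 + \<epsilon> *\<^sub>R c) ` C"
  have E: "compact E" "convex E"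
    using C' convex_scaling[OF C'(2), of \<epsilon>] compact_translate_scale[OF C'(1), of 0 \<epsilon>] by (simp_all add: E_def)
  \<comment> \<open>Adding \<open>\<epsilon> C\<close> ensures positive volume even when
    \<open>S\<close> lies in a hyperplane.\<close>
  define K where "K = (\<Union>x\<in>T. \<Union>y\<in>E. {x + y})"
  have K: "compact K" "convex K"
    unfolding K_def using T E compact_sums'[of T E] convex_sums[of T E] by auto
  have "(\<lambda>c. s + \<epsilon> *\<^sub>R c) ` C \<subseteq> K"
    using s(1) T(3) by (auto simp: K_def E_def)
  then have "measure lebesgue ((\<lambda>c. s + \<epsilon> *\<^sub>R c) ` C) \<le> measure lebesgue K"
    using C' K by (intro measure_mono_fmeasurable lmeasurable_compact fmeasurableD compact_translate_scale)
  moreover have "0 < measure lebesgue ((\<lambda>c. s + \<epsilon> *\<^sub>R c) ` C)"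
    unfolding measure_lebesgue_translate_scale using \<epsilon> measure_convex_body_pos[OF C(1)] by simp
  ultimately have K_pos: "0 < measure lebesgue K"
    by linarith
  have S_sub: "S \<subseteq> K"
  proof
    fix x assume "x \<in> S"
    obtain e where "0 < e" "ball 0 e \<subseteq> C"
      using zero_in_interior_symmetric[OF C] .
    then have "0 \<in> C"
      using centre_in_ball by blast
    then have "0 + \<epsilon> *\<^sub>R 0 \<in> E"
      unfolding E_def by (rule imageI)
    then have "0 \<in> E"
      by simp
    then have "x + 0 \<in> K"
      using \<open>x \<in> S\<close> T(3) unfolding K_def by blast
    then show "x \<in> K"
      by simp
  qed
  \<comment> \<open>Symmetry turns \<open>\<epsilon> (C - C)\<close> into
    \<open>2 \<epsilon> C\<close>, so that
    \<open>K - K \<subseteq> d C + 2 \<epsilon> C\<close>.\<close>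
  have K_diff: "\<exists>c\<in>C. x - y = (d + 2 * \<epsilon>) *\<^sub>R c" if xy: "x \<in> K" "y \<in> K" for x y
  proof -
    obtain a u b v where ab: "a \<in> T" "b \<in> T" "u \<in> C" "v \<in> C" "x = a + \<epsilon> *\<^sub>R u" "y = b + \<epsilon> *\<^sub>R v"
      using xy by (auto simp: K_def E_def)
    obtain c where c: "c \<in> C" "a - b = d *\<^sub>R c"
      using T_diff[OF ab(1,2)] by blast
    have "- v \<in> C"
      using C ab(4) by (simp add: centrally_symmetric_def)
    then obtain w where w: "w \<in> C" "\<epsilon> *\<^sub>R u + \<epsilon> *\<^sub>R (- v) = (\<epsilon> + \<epsilon>) *\<^sub>R w"
      using convex_scaleR_add_scaleR[OF C'(2) ab(3), of "- v" \<epsilon> \<epsilon>] \<epsilon> by auto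
    obtain z where z: "z \<in> C" "d *\<^sub>R c + (\<epsilon> + \<epsilon>) *\<^sub>R w = (d + (\<epsilon> + \<epsilon>)) *\<^sub>R z"
      using convex_scaleR_add_scaleR[OF C'(2) c(1) w(1), of d "\<epsilon> + \<epsilon>"] \<epsilon> d by auto
    have "x - y = (a - b) + (\<epsilon> *\<^sub>R u + \<epsilon> *\<^sub>R (- v))"
      by (simp add: ab(5,6))
    also have "\<dots> = (d + (\<epsilon> + \<epsilon>)) *\<^sub>R z"
      by (simp only: c(2) w(2) z(2))
    finally show ?thesis
      using z(1) by auto
  qed
  have "\<mu> + \<delta> \<le> 1"
    using \<delta>\<mu>(1,3) by simp
  then obtain X where X: "finite X" "K \<subseteq> (\<Union>x\<in>X. (\<lambda>k. x - (\<mu> + \<delta>) *\<^sub>R k) ` K)"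
    "real (card X) \<le> (2 / \<mu>) ^ n * (n * ln (1 + 2 / \<delta>)) + 1 + 2 ^ n"
    using reflected_cover[OF K K_pos \<delta>\<mu>(2,1)] unfolding DIM by blast
  obtain h where h: "bij_betw h {0..<card X} X"
    using ex_bij_betw_nat_finite[OF X(1)] by blast
  have \<lambda>: "0 < 1 - \<delta>"
    using \<delta>\<mu> by linarith
  \<comment> \<open>Intersecting with \<open>S\<close> makes the union equal to \<open>S\<close>
    instead of merely covering it. The reflection only swaps the two points of a difference, so the
    diameter just scales by \<open>1 - \<delta>\<close>.\<close>
  define A where "A i = S \<inter> (\<lambda>k. h i - (1 - \<delta>) *\<^sub>R k) ` K" for i
  have "diameter_of C (A i) < d" for i
  proof -
    have "diameter_of C (A i) \<le> (1 - \<delta>) * (d + 2 * \<epsilon>)"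
    proof (rule diameter_of_le)
      fix x y assume "x \<in> A i" "y \<in> A i"
      then obtain k l where kl: "k \<in> K" "l \<in> K" "x = h i - (1 - \<delta>) *\<^sub>R k" "y = h i - (1 - \<delta>) *\<^sub>R l"
        by (auto simp: A_def)
      obtain c where c: "c \<in> C" "l - k = (d + 2 * \<epsilon>) *\<^sub>R c"
        using K_diff[OF kl(2,1)] by blast
      have "x - y = (1 - \<delta>) *\<^sub>R (l - k)"
        unfolding kl(3,4) by (simp add: algebra_simps)
      then have "x - y = ((1 - \<delta>) * (d + 2 * \<epsilon>)) *\<^sub>R c"
        by (simp add: c(2))
      then show "norm_of C (x - y) \<le> (1 - \<delta>) * (d + 2 * \<epsilon>)"
        using \<lambda> d \<epsilon> c(1) by (intro norm_of_attained(2)[OF C]) auto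
    qed (use \<lambda> d \<epsilon> in auto)
    also have "\<dots> = d - d * \<delta>\<^sup>2"
      by (simp add: \<epsilon>_def algebra_simps power2_eq_square)
    also have "\<dots> < d"
      using d \<delta>\<mu> by simp
    finally show ?thesis .
  qed
  moreover have "S = (\<Union>i<card X. A i)"
  proof
    show "S \<subseteq> (\<Union>i<card X. A i)"
    proof
      fix x assume x: "x \<in> S"
      then obtain p where p: "p \<in> X" "x \<in> (\<lambda>k. p - (1 - \<delta>) *\<^sub>R k) ` K"
        using S_sub X(2) unfolding \<delta>\<mu>(3) by blast
      have "p \<in> h ` {0..<card X}"
        using h p(1) by (simp add: bij_betw_def)
      then obtain i where "i < card X" "h i = p"
        by auto
      then show "x \<in> (\<Union>i<card X. A i)"
        using x p(2) by (auto simp: A_def)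
    qed
  qed (auto simp: A_def)
  ultimately have "divisible_into C S (card X)"
    unfolding divisible_into_def d_def by blast
  then show ?thesis
    using X(3) bound by (intro borsuk_number_le) auto
qed

end
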